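(* Suppose that: (A1) for each $i\in I$ there are $\theta_i\in(0,1]$ and a constant $H_i$ with $\|\nabla f_i(x)-\nabla f_i(y)\|\le H_i\|y-x\|^{\theta_i}$ for all $x,y\in\Omega$; (A2) for each $i\in I$ there exists $f_i^*\in\mathbb{R}$ such that $f_i(x)\ge f_i^*$ for all $x\in\Omega$; (A3) $\lim_{T\to+\infty}\frac1T\sum_{k=0}^{T-1}[\nu_k]_i=0$ for each $i\in I$. Let $\{x_k\}_{k\ge0}$ be a sequence generated by the Universal Nonmonotone Line Search Method (with associated sequence $\{\nu_k\}_{k\ge0}$). Then either there exists $\bar k$ such that $s(x_{\bar k})=0$, or $$\liminf_{k\to+\infty}\|s(x_k)\|=0.$$
   Context: Setting: $\emptyset\ne\Omega\subset\mathbb{R}^n$ is closed and convex, $F=(f_1,\ldots,f_m)^T:\mathbb{R}^n\to\mathbb{R}^m$ is continuously differentiable (possibly nonconvex), $I=\{1,\ldots,m\}$, $\|\cdot\|$ is the Euclidean norm, $\mathbb{R}^m_+=\{z\in\mathbb{R}^m: z_i\ge0,\ i\in I\}$. For $x\in\Omega$, $\Omega-x=\{y\in\mathbb{R}^n: y+x\in\Omega\}$, and $s(x)$ is the unique minimizer over $d\in\Omega-x$ of $\max_{i\in I}\{\nabla f_i(x)^Td\}+\frac12\|d\|^2$. Universal Nonmonotone Line Search Method. Parameters: $x_0\in\Omega$, $m_0\in\{0,1,\ldots,m\}$, $c_1,c_2>0$, $\beta,\rho\in(0,1)$. At each iteration $k=0,1,2,\ldots$: (Step 1) choose $d(x_k)\in\Omega-x_k$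 with $\max_{i\in I}\{\nabla f_i(x_k)^Td(x_k)\}\le-c_1\|s(x_k)\|^2$ and $\|d(x_k)\|\le c_2\|s(x_k)\|$. (Step 2) For $\ell=0,1,2,\ldots$ choose $\nu_{k,\ell}\in\mathbb{R}^m_+$ (arbitrarily), and let $\ell_k$ be the first $\ell$ for which both of the following hold: (i) the number of indices $i\in I$ with $f_i(x_k+\beta^\ell d(x_k))\le f_i(x_k)+\rho\beta^\ell\nabla f_i(x_k)^Td(x_k)$ is at least $m_k$; (ii) $f_i(x_k+\beta^\ell d(x_k))\le f_i(x_k)+\rho\beta^\ell\nabla f_i(x_k)^Td(x_k)+[\nu_{k,\ell}]_i$ for all $i\in I$. (Step 3) Set $\alpha_k=\beta^{\ell_k}$, $x_{k+1}=x_k+\alpha_kd(x_k)$, $\nu_k=\nu_{k,\ell_k}$, and choose $m_{k+1}\in\{0,1,\ldots,m\}$ (arbitrarily). *)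

theory Defs
  imports "HOL-Analysis.Analysis"
begin

definition continuously_differentiable ::
    "('a::real_normed_vector \<Rightarrow> 'b::real_normed_vector) \<Rightarrow> bool" where
  "continuously_differentiable f \<longleftrightarrow>
    (\<exists>f' :: 'a \<Rightarrow> 'a \<Rightarrow>\<^sub>L 'b.
      (\<forall>x. (f has_derivative blinfun_apply (f' x)) (at x)) \<and> continuous_on UNIV f')"

text \<open>Meaningful only where \<open>f\<close> is differentiable; there the gradient is unique.\<close>

definition gradient :: "('a::real_inner \<Rightarrow> real) \<Rightarrow> 'a \<Rightarrow> 'a" where
  "gradient f x = (THE D. GDERIV f x :> D)"

abbreviation comp_grad :: "(real^'n \<Rightarrow> real^'m) \<Rightarrow> 'm \<Rightarrow> real^'n \<Rightarrow> real^'n" where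
  "comp_grad F i x \<equiv> gradient (\<lambda>y. F y $ i) x"

definition feasible_dirs :: "(real^'n) set \<Rightarrow> real^'n \<Rightarrow> (real^'n) set" where
  "feasible_dirs \<Omega> x = {y. y + x \<in> \<Omega>}"

definition max_slope :: "(real^'n \<Rightarrow> real^'m) \<Rightarrow> real^'n \<Rightarrow> real^'n \<Rightarrow> real" where
  "max_slope F x d = Max (range (\<lambda>i. comp_grad F i x \<bullet> d))"

text \<open>For \<open>x \<in> \<Omega>\<close> with \<open>\<Omega>\<close> closed and convex, the objective is continuous, strongly convex and
  the feasible set is nonempty, so exactly one minimizer exists.\<close>

definition search_dir :: "(real^'n) set \<Rightarrow> (real^'n \<Rightarrow> real^'m) \<Rightarrow> real^'n \<Rightarrow> real^'n" where
  "search_dir \<Omega> F x =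
    (THE d. is_arg_min (\<lambda>d. max_slope F x d + 1/2 * (norm d)^2) (\<lambda>d. d \<in> feasible_dirs \<Omega> x) d)"

text \<open>The two conditions tested for the step size \<open>\<alpha>\<close>, with at least \<open>p\<close> components
  satisfying the monotone condition and \<open>v\<close> the nonmonotonicity vector.\<close>

definition step_accepted ::
    "(real^'n \<Rightarrow> real^'m) \<Rightarrow> real \<Rightarrow> nat \<Rightarrow> real^'n \<Rightarrow> real^'n \<Rightarrow> real \<Rightarrow> real^'m \<Rightarrow> bool" where
  "step_accepted F \<rho> p x d \<alpha> v \<longleftrightarrow>
    card {i. F (x + \<alpha> *\<^sub>R d) $ i \<le> F x $ i + \<rho> * \<alpha> * (comp_grad F i x \<bullet> d)} \<ge> p \<and>
    (\<forall>i. F (x + \<alpha> *\<^sub>R d) $ i \<le> F x $ i + \<rho> * \<alpha> * (comp_grad F i x \<bullet> d) + v $ i)"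

text \<open>The infinite runs of the universal nonmonotone line search method:
  \<open>x\<close> iterates, \<open>d\<close> directions, \<open>p k\<close> is the number \<open>m\<^sub>k\<close>, \<open>\<nu> k l\<close> the vectors chosen during
  the line search and \<open>L k\<close> the accepted exponent \<open>\<ell>\<^sub>k\<close>. The vectors \<open>\<nu> k l\<close> with \<open>l > L k\<close> are
  never chosen by the method, hence unconstrained.\<close>

definition unls_run ::
    "(real^'n) set \<Rightarrow> (real^'n \<Rightarrow> real^'m) \<Rightarrow> real \<Rightarrow> real \<Rightarrow> real \<Rightarrow> real \<Rightarrow>
     (nat \<Rightarrow> real^'n) \<Rightarrow> (nat \<Rightarrow> real^'n) \<Rightarrow> (nat \<Rightarrow> nat) \<Rightarrow>
     (nat \<Rightarrow> nat \<Rightarrow> real^'m) \<Rightarrow> (nat \<Rightarrow> nat) \<Rightarrow> bool" where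
  "unls_run \<Omega> F c1 c2 \<beta> \<rho> x d p \<nu> L \<longleftrightarrow>
    x 0 \<in> \<Omega> \<and>
    (\<forall>k. p k \<le> CARD('m)) \<and>
    (\<forall>k. d k \<in> feasible_dirs \<Omega> (x k) \<and>
         max_slope F (x k) (d k) \<le> - c1 * (norm (search_dir \<Omega> F (x k)))^2 \<and>
         norm (d k) \<le> c2 * norm (search_dir \<Omega> F (x k))) \<and>
    (\<forall>k. \<forall>l\<le>L k. \<forall>i. 0 \<le> \<nu> k l $ i) \<and>
    (\<forall>k. step_accepted F \<rho> (p k) (x k) (d k) (\<beta> ^ L k) (\<nu> k (L k)) \<and>
         (\<forall>l<L k. \<not> step_accepted F \<rho> (p k) (x k) (d k) (\<beta> ^ l) (\<nu> k l))) \<and>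
    (\<forall>k. x (Suc k) = x k + \<beta> ^ L k *\<^sub>R d k)"

end

theory Submission
  imports Defs
begin

text \<open>Suppose the norms of \<open>s(x\<^sub>k)\<close> are eventually at least some \<open>\<epsilon> > 0\<close>. The mean value theorem and
  the Hoelder bound on the gradients show that a step size failing the Armijo test
  cannot be too small, uniformly in \<open>k\<close>; hence the accepted step sizes are bounded below. Every step
  then decreases each \<open>f\<^sub>i\<close> by a fixed amount \<open>\<eta> > 0\<close> up to the error \<open>[\<nu>\<^sub>k]\<^sub>i\<close>. Since these errors
  vanish on average, \<open>f\<^sub>i(x\<^sub>k)\<close> would tend to \<open>-\<infinity>\<close>.\<close>

lemma continuously_differentiable_imp_differentiable:
  "continuously_differentiable f \<Longrightarrow> f differentiable at x"
  unfolding continuously_differentiable_def differentiable_def by blast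

text \<open>Since \<open>gradient\<close> is a definite description, existence and uniqueness are
  both due. Applying the adjoint of the derivative to 1 gives the Riesz vector of the linear
  functional, and a vector is determined by its inner products.\<close>

lemma GDERIV_gradient:
  fixes f :: "'a::euclidean_space \<Rightarrow> real"
  assumes "f differentiable at x"
  shows "GDERIV f x :> gradient f x"
proof -
  obtain f' where f': "(f has_derivative f') (at x)"
    using assms unfolding differentiable_def by blast
  have "f' = (\<lambda>h. h \<bullet> adjoint f' 1)"
    using adjoint_works[OF has_derivative_linear[OF f'], of _ 1] by (simp add: fun_eq_iff)
  from has_derivative_eq_rhs[OF f' this] have ex: "GDERIV f x :> adjoint f' 1"
    unfolding gderiv_def .
  have "D = D'" if "GDERIV f x :> D" and "GDERIV f x :> D'" for D D'
  proof -
    have "(\<lambda>h. h \<bullet> D) = (\<lambda>h. h \<bullet> D')"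
      using that unfolding gderiv_def by (rule has_derivative_unique)
    then show ?thesis by (simp only: fun_eq_iff vector_eq_ldot)
  qed
  with ex show ?thesis unfolding gradient_def by (blast intro: theI)
qed

lemma GDERIV_comp_grad:
  fixes F :: "real^'n \<Rightarrow> real^'m"
  assumes "F differentiable at x"
  shows "GDERIV (\<lambda>y. F y $ i) x :> comp_grad F i x"
proof (rule GDERIV_gradient)
  show "(\<lambda>y. F y $ i) differentiable at x"
    using assms unfolding differentiable_def
    by (blast intro: bounded_linear.has_derivative[OF bounded_linear_vec_nth])
qed

lemma GDERIV_DERIV_along_line:
  fixes f :: "'a::real_inner \<Rightarrow> real"
  assumes "GDERIV f (x + t *\<^sub>R d) :> D"
  shows "((\<lambda>s. f (x + s *\<^sub>R d)) has_real_derivative D \<bullet> d) (at t)"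
proof -
  have "((\<lambda>s. x + s *\<^sub>R d) has_derivative (\<lambda>h. h *\<^sub>R d)) (at t)"
    by (auto intro!: derivative_eq_intros)
  from diff_chain_at[OF this assms[unfolded gderiv_def]]
  have "((\<lambda>s. f (x + s *\<^sub>R d)) has_derivative (\<lambda>h. h *\<^sub>R d \<bullet> D)) (at t)"
    by (simp only: o_def)
  moreover have "(\<lambda>h. h *\<^sub>R d \<bullet> D) = (*) (D \<bullet> d)"
    by (rule ext) (simp add: inner_commute)
  ultimately show ?thesis
    by (simp only: has_field_derivative_def)
qed

text \<open>By the mean value theorem on the segment, the slope at some intermediate
  \<open>t\<close> equals the average slope, which failure of the test puts above \<rho> times the
  initial slope. Subtracting the initial slope turns this into a lower bound on the change of
  gradient.\<close>

lemma armijo_failure_gradient_change: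
  fixes f :: "'a::real_inner \<Rightarrow> real"
  assumes diff: "\<And>y. GDERIV f y :> G y"
    and \<alpha>: "0 < \<alpha>"
    and fail: "f (x + \<alpha> *\<^sub>R d) > f x + \<rho> * \<alpha> * (G x \<bullet> d)"
  obtains t where "0 < t" "t < \<alpha>" "(1 - \<rho>) * - (G x \<bullet> d) < (G (x + t *\<^sub>R d) - G x) \<bullet> d"
proof -
  obtain t where t: "0 < t" "t < \<alpha>"
    and mvt: "f (x + \<alpha> *\<^sub>R d) - f (x + 0 *\<^sub>R d) = (\<alpha> - 0) * (G (x + t *\<^sub>R d) \<bullet> d)"
    using MVT2[OF \<alpha>, of "\<lambda>s. f (x + s *\<^sub>R d)" "\<lambda>s. G (x + s *\<^sub>R d) \<bullet> d"]
      GDERIV_DERIV_along_line[OF diff] by blast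
  have "\<alpha> * (\<rho> * (G x \<bullet> d)) < \<alpha> * (G (x + t *\<^sub>R d) \<bullet> d)"
    using mvt fail by (simp add: algebra_simps)
  then have "\<rho> * (G x \<bullet> d) < G (x + t *\<^sub>R d) \<bullet> d"
    using \<alpha> by simp
  then show ?thesis
    using t by (intro that[of t]) (simp_all add: algebra_simps)
qed

text \<open>The gradient change forced by a failed test is bounded above by Cauchy-Schwarz and the
  Hoelder condition, in terms of a power of \<alpha>; solving for \<alpha> gives the bound. The
  quantifier order matters: \<delta> is chosen before \<open>x\<close>, \<open>d\<close> and
  \<open>s\<close>, so one bound serves all iterations with \<open>s\<close> at least
  \<epsilon>.\<close>

lemma armijo_failure_step_lower_bound:
  fixes f :: "'a::real_inner \<Rightarrow> real"
  assumes diff: "\<And>y. GDERIV f y :> G y"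
    and cvx: "convex \<Omega>"
    and \<theta>: "0 < \<theta>" "\<theta> \<le> 1"
    and hoelder: "\<And>u v. u \<in> \<Omega> \<Longrightarrow> v \<in> \<Omega> \<Longrightarrow> norm (G u - G v) \<le> H * norm (v - u) powr \<theta>"
    and pos: "0 < c1" "0 < c2" "\<rho> < 1" "0 < \<epsilon>"
  shows "\<exists>\<delta>>0. \<forall>x d \<alpha> s. x \<in> \<Omega> \<longrightarrow> x + d \<in> \<Omega> \<longrightarrow> 0 < \<alpha> \<longrightarrow> \<alpha> \<le> 1 \<longrightarrow> \<epsilon> \<le> s \<longrightarrow>
    G x \<bullet> d \<le> - c1 * s\<^sup>2 \<longrightarrow> norm d \<le> c2 * s \<longrightarrow>
    f x + \<rho> * \<alpha> * (G x \<bullet> d) < f (x + \<alpha> *\<^sub>R d) \<longrightarrow> \<delta> \<le> \<alpha>"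
proof -
  \<comment> \<open>\<open>H\<close> may be zero or negative, so it is replaced by a positive
    constant that can be divided by.\<close>
  define K where "K = \<bar>H\<bar> + 1"
  define C where "C = (1 - \<rho>) * c1 * \<epsilon> powr (1 - \<theta>) / (K * c2 * c2 powr \<theta>)"
  have K: "0 < K" "H \<le> K" unfolding K_def by auto
  have C: "0 < C" unfolding C_def using pos K by simp
  have "C powr (1 / \<theta>) \<le> \<alpha>"
    if x: "x \<in> \<Omega>" "x + d \<in> \<Omega>" and \<alpha>: "0 < \<alpha>" "\<alpha> \<le> 1" and s: "\<epsilon> \<le> s"
      and slope: "G x \<bullet> d \<le> - c1 * s\<^sup>2" and nd: "norm d \<le> c2 * s"
      and fail: "f x + \<rho> * \<alpha> * (G x \<bullet> d) < f (x + \<alpha> *\<^sub>R d)"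
    for x d \<alpha> s
  proof -
    have s0: "0 < s" using s pos by simp
    obtain t where t: "0 < t" "t < \<alpha>"
      and change: "(1 - \<rho>) * - (G x \<bullet> d) < (G (x + t *\<^sub>R d) - G x) \<bullet> d"
      using armijo_failure_gradient_change[OF diff \<alpha>(1) fail] .
    \<comment> \<open>The Hoelder bound is available only on \<Omega>; since \<open>t < 1\<close>,
      the intermediate point is a convex combination of \<open>x\<close> and
      \<open>x + d\<close>.\<close>
    have "(1 - t) *\<^sub>R x + t *\<^sub>R (x + d) \<in> \<Omega>"
      using cvx x t \<alpha> by (intro convexD) auto
    then have xt: "x + t *\<^sub>R d \<in> \<Omega>" by (simp add: algebra_simps)
    have "norm (G (x + t *\<^sub>R d) - G x) \<le> H * norm (t *\<^sub>R d) powr \<theta>"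
      using hoelder[OF xt x(1)] by simp
    also have "\<dots> \<le> K * norm (t *\<^sub>R d) powr \<theta>"
      using K by (intro mult_right_mono) auto
    also have "\<dots> \<le> K * (\<alpha> * (c2 * s)) powr \<theta>"
      using K t nd \<alpha> \<theta> by (intro mult_left_mono powr_mono2) (auto intro!: mult_mono)
    finally have dG: "norm (G (x + t *\<^sub>R d) - G x) \<le> K * (\<alpha> * (c2 * s)) powr \<theta>" .
    have "(1 - \<rho>) * (c1 * s\<^sup>2) \<le> (1 - \<rho>) * - (G x \<bullet> d)"
      using slope pos by (intro mult_left_mono) auto
    also have "\<dots> < (G (x + t *\<^sub>R d) - G x) \<bullet> d" by (rule change)
    also have "\<dots> \<le> norm (G (x + t *\<^sub>R d) - G x) * norm d" by (rule norm_cauchy_schwarz)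
    also have "\<dots> \<le> (K * (\<alpha> * (c2 * s)) powr \<theta>) * (c2 * s)"
      using dG nd K by (intro mult_mono) auto
    finally have "s * ((1 - \<rho>) * c1 * s) < s * (K * c2 * (\<alpha> * (c2 * s)) powr \<theta>)"
      by (simp add: power2_eq_square ac_simps)
    then have main: "(1 - \<rho>) * c1 * s < K * c2 * (\<alpha> * (c2 * s)) powr \<theta>"
      using s0 by simp
    \<comment> \<open>Splitting \<open>s\<close> into its powers with exponents
      \<open>1 - \<theta>\<close> and \<theta> lets the second cancel against the right-hand side.
      The first is at least the same power of \<epsilon> because \<theta> is at most 1.\<close>
    have "\<epsilon> powr (1 - \<theta>) * s powr \<theta> \<le> s powr (1 - \<theta>) * s powr \<theta>"
      using s pos \<theta> by (intro mult_right_mono powr_mono2) auto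
    also have "\<dots> = s" using s0 by (simp flip: powr_add)
    finally have "(1 - \<rho>) * c1 * (\<epsilon> powr (1 - \<theta>) * s powr \<theta>) \<le> (1 - \<rho>) * c1 * s"
      using pos by (intro mult_left_mono) auto
    also note main
    also have "K * c2 * (\<alpha> * (c2 * s)) powr \<theta> = (K * c2 * c2 powr \<theta> * \<alpha> powr \<theta>) * s powr \<theta>"
      using \<alpha> pos s0 by (simp add: powr_mult)
    finally have "((1 - \<rho>) * c1 * \<epsilon> powr (1 - \<theta>)) * s powr \<theta>
        < (K * c2 * c2 powr \<theta> * \<alpha> powr \<theta>) * s powr \<theta>"
      by (simp add: ac_simps)
    then have "(1 - \<rho>) * c1 * \<epsilon> powr (1 - \<theta>) < K * c2 * c2 powr \<theta> * \<alpha> powr \<theta>"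
      using s0 by simp
    then have "C < \<alpha> powr \<theta>"
      unfolding C_def using K pos by (simp add: pos_divide_less_eq ac_simps)
    then have "C powr (1 / \<theta>) \<le> (\<alpha> powr \<theta>) powr (1 / \<theta>)"
      using C \<theta> by (intro powr_mono2) auto
    also have "\<dots> = \<alpha>" using \<alpha> \<theta> by (simp add: powr_powr)
    finally show ?thesis .
  qed
  moreover have "0 < C powr (1 / \<theta>)" using C by simp
  ultimately show ?thesis by blast
qed

text \<open>If \<open>a\<close> stayed above \<open>b\<close>, telescoping would bound the average
  error up to time \<open>T\<close> below by \<eta> plus a term of order \<open>1 / T\<close>;
  letting \<open>T\<close> grow would give \<eta> at most 0.\<close>

lemma vanishing_average_error_not_bounded_below:
  fixes a e :: "nat \<Rightarrow> real"
  assumes descent: "\<And>k. k \<ge> K \<Longrightarrow> a (Suc k) \<le> a k - \<eta> + e k"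
    and e: "\<And>k. 0 \<le> e k"
    and avg: "(\<lambda>T. 1 / real T * (\<Sum>k<T. e k)) \<longlonglongrightarrow> 0"
    and \<eta>: "0 < \<eta>"
  shows "\<exists>k. a k < b"
proof (rule ccontr)
  assume "\<not> (\<exists>k. a k < b)"
  then have lower: "b \<le> a k" for k by (simp add: not_less)
  \<comment> \<open>The error sum starts at 0 rather than at \<open>K\<close> so that it matches the
    averages in \<open>avg\<close>; the extra terms are harmless because they are
    nonnegative.\<close>
  have tele: "a T \<le> a K - real (T - K) * \<eta> + (\<Sum>k<T. e k)" if "K \<le> T" for T
    using that
  proof (induction T rule: dec_induct)
    case base
    show ?case using sum_nonneg[of "{..<K}" e] e by simp
  next
    case (step T)
    then show ?case
      using descent[of T] by (simp add: Suc_diff_le algebra_simps)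
  qed
  have "(\<lambda>T. (b - a K - real K * \<eta>) * (1 / real T) + \<eta>) \<longlonglongrightarrow> (b - a K - real K * \<eta>) * 0 + \<eta>"
    by (intro tendsto_intros lim_1_over_n)
  moreover have "\<forall>\<^sub>F T in sequentially.
      (b - a K - real K * \<eta>) * (1 / real T) + \<eta> \<le> 1 / real T * (\<Sum>k<T. e k)"
    \<comment> \<open>Starting from \<open>Suc K\<close> makes \<open>tele\<close> applicable and
      also ensures that \<open>T\<close> is positive, as the division requires.\<close>
    using eventually_ge_at_top[of "Suc K"]
  proof eventually_elim
    case (elim T)
    then have "b - a K - real K * \<eta> + real T * \<eta> \<le> (\<Sum>k<T. e k)"
      using tele[of T] lower[of T] by (simp add: of_nat_diff algebra_simps)
    then have "1 / real T * (b - a K - real K * \<eta> + real T * \<eta>) \<le> 1 / real T * (\<Sum>k<T. e k)"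
      by (intro mult_left_mono) auto
    then show ?case using elim by (simp add: field_simps)
  qed
  ultimately have "\<eta> \<le> 0"
    using tendsto_le[OF _ avg] by fastforce
  with \<eta> show False by simp
qed

lemma comp_grad_le_max_slope: "comp_grad F i x \<bullet> d \<le> max_slope F x d"
  unfolding max_slope_def by (rule Max_ge) auto

text \<open>When every component passes the monotone test, the count is the full
  \<open>CARD('m)\<close>, and adding a nonnegative \<open>v\<close> only relaxes the bound. It is
  used in contrapositive form: a rejected trial step has some component that fails the Armijo
  test.\<close>

lemma step_accepted_if_monotone:
  fixes F :: "real^'n \<Rightarrow> real^'m"
  assumes "\<And>i. F (x + \<alpha> *\<^sub>R d) $ i \<le> F x $ i + \<rho> * \<alpha> * (comp_grad F i x \<bullet> d)"
    and "p \<le> CARD('m)" and "\<And>i. 0 \<le> v $ i"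
  shows "step_accepted F \<rho> p x d \<alpha> v"
  unfolding step_accepted_def using assms by (auto intro: add_increasing2)

theorem corollary3p7:
  fixes \<Omega> :: "(real^'n) set" and F :: "real^'n \<Rightarrow> real^'m"
    and c1 c2 \<beta> \<rho> :: real
    and x d :: "nat \<Rightarrow> real^'n" and p L :: "nat \<Rightarrow> nat"
    and \<nu> :: "nat \<Rightarrow> nat \<Rightarrow> real^'m"
  assumes "\<Omega> \<noteq> {}" and "closed \<Omega>" and "convex \<Omega>"
    and "continuously_differentiable F"
    and "c1 > 0" and "c2 > 0" and "0 < \<beta>" and "\<beta> < 1" and "0 < \<rho>" and "\<rho> < 1"
    and A1: "\<forall>i. \<exists>\<theta> H :: real. 0 < \<theta> \<and> \<theta> \<le> 1 \<and>
      (\<forall>u\<in>\<Omega>. \<forall>v\<in>\<Omega>. norm (comp_grad F i u - comp_grad F i v) \<le> H * norm (v - u) powr \<theta>)"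
    and A2: "\<forall>i. \<exists>fstar :: real. \<forall>u\<in>\<Omega>. F u $ i \<ge> fstar"
    and run: "unls_run \<Omega> F c1 c2 \<beta> \<rho> x d p \<nu> L"
    and A3: "\<forall>i. (\<lambda>T::nat. 1 / real T * (\<Sum>k<T. \<nu> k (L k) $ i)) \<longlonglongrightarrow> 0"
  shows "(\<exists>k. search_dir \<Omega> F (x k) = 0) \<or>
    liminf (\<lambda>k. ereal (norm (search_dir \<Omega> F (x k)))) = 0"
proof -
  let ?s = "\<lambda>k. norm (search_dir \<Omega> F (x k))"
  have x0: "x 0 \<in> \<Omega>" and p: "p k \<le> CARD('m)" and dir: "x k + d k \<in> \<Omega>"
    and slope: "max_slope F (x k) (d k) \<le> - c1 * (?s k)\<^sup>2"
    and nd: "norm (d k) \<le> c2 * ?s k"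
    and nu: "\<And>l i. l \<le> L k \<Longrightarrow> 0 \<le> \<nu> k l $ i"
    and acc: "step_accepted F \<rho> (p k) (x k) (d k) (\<beta> ^ L k) (\<nu> k (L k))"
    and rej: "\<And>l. l < L k \<Longrightarrow> \<not> step_accepted F \<rho> (p k) (x k) (d k) (\<beta> ^ l) (\<nu> k l)"
    and upd: "x (Suc k) = x k + \<beta> ^ L k *\<^sub>R d k" for k
    using run unfolding unls_run_def feasible_dirs_def by (auto simp: add.commute)
  have pow: "0 < \<beta> ^ l" "\<beta> ^ l \<le> 1" for l
    using \<open>0 < \<beta>\<close> \<open>\<beta> < 1\<close> by (auto intro: power_le_one)
  have x_in: "x k \<in> \<Omega>" for k
  proof (induction k)
    case (Suc k)
    have "(1 - \<beta> ^ L k) *\<^sub>R x k + \<beta> ^ L k *\<^sub>R (x k + d k) \<in> \<Omega>"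
      using \<open>convex \<Omega>\<close> Suc dir[of k] pow[of "L k"] by (intro convexD) auto
    then show ?case unfolding upd by (simp add: algebra_simps)
  qed (rule x0)
  have cslope: "comp_grad F i (x k) \<bullet> d k \<le> - c1 * (?s k)\<^sup>2" for i k
    using comp_grad_le_max_slope slope by (rule order_trans)
  have grad: "GDERIV (\<lambda>y. F y $ i) y :> comp_grad F i y" for i y
    by (intro GDERIV_comp_grad continuously_differentiable_imp_differentiable) fact
  have "liminf (\<lambda>k. ereal (?s k)) = 0"
  proof (rule ccontr)
    assume "liminf (\<lambda>k. ereal (?s k)) \<noteq> 0"
    moreover have "0 \<le> liminf (\<lambda>k. ereal (?s k))"
      by (intro Liminf_bounded always_eventually) auto
    ultimately have "0 < liminf (\<lambda>k. ereal (?s k))" by simp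
    \<comment> \<open>The limit inferior may be infinite, so a real number strictly between 0 and it
      is chosen.\<close>
    then obtain \<epsilon> where \<epsilon>: "0 < ereal \<epsilon>" "ereal \<epsilon> < liminf (\<lambda>k. ereal (?s k))"
      using ereal_dense2 by blast
    then obtain K where s_ge: "\<epsilon> \<le> ?s k" if "k \<ge> K" for k
      using less_LiminfD[OF \<epsilon>(2)] unfolding eventually_sequentially by (auto intro: less_imp_le)
    have \<epsilon>0: "0 < \<epsilon>" using \<epsilon> by simp
    have "\<forall>i. \<exists>\<delta>>0. \<forall>x d \<alpha> s. x \<in> \<Omega> \<longrightarrow> x + d \<in> \<Omega> \<longrightarrow> 0 < \<alpha> \<longrightarrow> \<alpha> \<le> 1 \<longrightarrow> \<epsilon> \<le> s \<longrightarrow>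
      comp_grad F i x \<bullet> d \<le> - c1 * s\<^sup>2 \<longrightarrow> norm d \<le> c2 * s \<longrightarrow>
      F x $ i + \<rho> * \<alpha> * (comp_grad F i x \<bullet> d) < F (x + \<alpha> *\<^sub>R d) $ i \<longrightarrow> \<delta> \<le> \<alpha>"
    proof
      fix i
      obtain \<theta> H :: real where \<theta>: "0 < \<theta>" "\<theta> \<le> 1" and
        "\<forall>u\<in>\<Omega>. \<forall>v\<in>\<Omega>. norm (comp_grad F i u - comp_grad F i v) \<le> H * norm (v - u) powr \<theta>"
        using A1 by blast
      then show "\<exists>\<delta>>0. \<forall>x d \<alpha> s. x \<in> \<Omega> \<longrightarrow> x + d \<in> \<Omega> \<longrightarrow> 0 < \<alpha> \<longrightarrow> \<alpha> \<le> 1 \<longrightarrow> \<epsilon> \<le> s \<longrightarrow>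
        comp_grad F i x \<bullet> d \<le> - c1 * s\<^sup>2 \<longrightarrow> norm d \<le> c2 * s \<longrightarrow>
        F x $ i + \<rho> * \<alpha> * (comp_grad F i x \<bullet> d) < F (x + \<alpha> *\<^sub>R d) $ i \<longrightarrow> \<delta> \<le> \<alpha>"
        by (intro armijo_failure_step_lower_bound[OF grad \<open>convex \<Omega>\<close> \<theta> _
              \<open>0 < c1\<close> \<open>0 < c2\<close> \<open>\<rho> < 1\<close> \<epsilon>0]) auto
    qed
    then obtain D where D0: "\<And>i. 0 < D i" and
      D: "\<And>i x d \<alpha> s. x \<in> \<Omega> \<Longrightarrow> x + d \<in> \<Omega> \<Longrightarrow> 0 < \<alpha> \<Longrightarrow> \<alpha> \<le> 1 \<Longrightarrow> \<epsilon> \<le> s \<Longrightarrow>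
        comp_grad F i x \<bullet> d \<le> - c1 * s\<^sup>2 \<Longrightarrow> norm d \<le> c2 * s \<Longrightarrow>
        F x $ i + \<rho> * \<alpha> * (comp_grad F i x \<bullet> d) < F (x + \<alpha> *\<^sub>R d) $ i \<Longrightarrow> D i \<le> \<alpha>"
      by metis
    \<comment> \<open>The minimum over finitely many components stays positive. The inserted 1
      covers iterations that accept the full step at once, where no rejected trial gives a
      bound.\<close>
    define \<delta> where "\<delta> = Min (insert 1 (range D))"
    have \<delta>0: "0 < \<delta>" unfolding \<delta>_def using D0 by (subst Min_gr_iff) auto
    have \<delta>1: "\<delta> \<le> 1" and \<delta>D: "\<delta> \<le> D i" for i unfolding \<delta>_def by (simp_all add: min.coboundedI2)
    have step: "\<beta> * \<delta> \<le> \<beta> ^ L k" if "k \<ge> K" for k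
    proof (cases "L k")
      case 0
      then show ?thesis
        using \<open>0 < \<beta>\<close> \<open>\<beta> < 1\<close> \<delta>0 \<delta>1 by (simp add: mult_le_one)
    next
      case (Suc l)
      \<comment> \<open>The trial just before the accepted one was rejected, so its step is at least
        \<delta>; the accepted step is \<beta> times as long.\<close>
      then have "\<not> step_accepted F \<rho> (p k) (x k) (d k) (\<beta> ^ l) (\<nu> k l)" by (intro rej) simp
      then obtain i where
        "F (x k) $ i + \<rho> * \<beta> ^ l * (comp_grad F i (x k) \<bullet> d k) < F (x k + \<beta> ^ l *\<^sub>R d k) $ i"
        using step_accepted_if_monotone[where F = F and x = "x k" and d = "d k" and p = "p k"]
          p[of k] nu[of l k] Suc
        by (metis not_le le_SucI le_refl)
      then have "D i \<le> \<beta> ^ l"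
        using D[OF x_in dir pow s_ge[OF that] cslope nd] by blast
      with \<delta>D[of i] have "\<delta> \<le> \<beta> ^ l" by linarith
      then show ?thesis using Suc \<open>0 < \<beta>\<close> by simp
    qed
    \<comment> \<open>The guaranteed decrease: \<rho> times the lower bound on the step size times
      the lower bound on the negated slope.\<close>
    define \<eta> where "\<eta> = \<rho> * (\<beta> * \<delta>) * (c1 * \<epsilon>\<^sup>2)"
    have \<eta>0: "0 < \<eta>"
      unfolding \<eta>_def using \<open>0 < \<rho>\<close> \<open>0 < \<beta>\<close> \<delta>0 \<open>c1 > 0\<close> \<epsilon>0 by simp
    \<comment> \<open>The contradiction is obtained in a single, arbitrary component.\<close>
    fix i :: 'm
    have descent: "F (x (Suc k)) $ i \<le> F (x k) $ i - \<eta> + \<nu> k (L k) $ i" if "k \<ge> K" for k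
    proof -
      have "c1 * \<epsilon>\<^sup>2 \<le> c1 * (?s k)\<^sup>2"
        using s_ge[OF that] \<epsilon>0 \<open>c1 > 0\<close> by (intro mult_left_mono power_mono) auto
      also have "\<dots> \<le> - (comp_grad F i (x k) \<bullet> d k)" using cslope[of i k] by simp
      finally have "\<eta> \<le> \<rho> * \<beta> ^ L k * - (comp_grad F i (x k) \<bullet> d k)"
        unfolding \<eta>_def using step[OF that] \<open>0 < \<rho>\<close> \<open>c1 > 0\<close> \<open>0 < \<beta>\<close> \<delta>0 pow[of "L k"]
        by (intro mult_mono) auto
      moreover have "F (x (Suc k)) $ i \<le>
          F (x k) $ i + \<rho> * \<beta> ^ L k * (comp_grad F i (x k) \<bullet> d k) + \<nu> k (L k) $ i"
        using acc[of k] unfolding step_accepted_def upd by blast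
      ultimately show ?thesis by simp
    qed
    obtain fstar where "\<forall>u\<in>\<Omega>. F u $ i \<ge> fstar" using A2 by blast
    moreover have "\<exists>k. F (x k) $ i < fstar"
      using vanishing_average_error_not_bounded_below
        [where a = "\<lambda>k. F (x k) $ i" and e = "\<lambda>k. \<nu> k (L k) $ i", OF descent _ _ \<eta>0] nu A3
      by blast
    ultimately show False using x_in by (meson not_le)
  qed
  then show ?thesis ..
qed

end
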